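(* Let $R$ be a commutative ring and let $\mathfrak{a}\subseteq R$ be an ideal. If $\mathfrak{a}$ is of finite type (i.e. finitely generated), then every $R$-module is weakly $\mathfrak{a}$-quasifair.
   Context: Rings are commutative with unit (not assumed noetherian). $\mathrm{Var}(\mathfrak{a})$ is the set of prime ideals of $R$ containing $\mathfrak{a}$, and for an $R$-module $M$, $\Gamma_{\mathfrak{a}}(M)=\{x\in M\mid\exists n\in\mathbb{N}:\mathfrak{a}^nx=0\}$. For $x\in M$, $(0:_Rx)=\{r\in R\mid rx=0\}$. The weak assassin $\mathrm{Ass}^{\rm f}_R(M)$ is the set of prime ideals $\mathfrak{p}$ of $R$ such that there exists $x\in M$ for which $\mathfrak{p}$ is minimal (with respect to inclusion) among the prime ideals containing $(0:_Rx)$. An $R$-module $M$ is called weakly $\mathfrak{a}$-quasifair if $\mathrm{Ass}^{\rm f}_R(\Gamma_{\mathfrak{a}}(M))=\mathrm{Ass}^{\rm f}_R(M)\cap\mathrm{Var}(\mathfrak{a})$. *)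

theory Defs
  imports "HOL-Algebra.Module" "HOL-Algebra.Ideal_Product"
begin

definition Var :: "('a, 'c) ring_scheme \<Rightarrow> 'a set \<Rightarrow> 'a set set" where
  "Var R I = {P. primeideal P R \<and> I \<subseteq> P}"

(* Powers of ideals are taken in the monoid of ideals of R, with the ideal
   product as multiplication; in particular the 0-th power is carrier R. *)
definition ideal_pow :: "('a, 'c) ring_scheme \<Rightarrow> 'a set \<Rightarrow> nat \<Rightarrow> 'a set" where
  "ideal_pow R I n = I [^]\<^bsub>ideals_set R\<^esub> n"

definition torsion ::
    "('a, 'c) ring_scheme \<Rightarrow> 'a set \<Rightarrow> ('a, 'b, 'd) module_scheme \<Rightarrow> 'b set" where
  "torsion R I M =
     {x \<in> carrier M. \<exists>n::nat. \<forall>r \<in> ideal_pow R I n. r \<odot>\<^bsub>M\<^esub> x = \<zero>\<^bsub>M\<^esub>}"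

abbreviation torsion_module ::
    "('a, 'c) ring_scheme \<Rightarrow> 'a set \<Rightarrow> ('a, 'b, 'd) module_scheme \<Rightarrow> ('a, 'b, 'd) module_scheme" where
  "torsion_module R I M \<equiv> M\<lparr>carrier := torsion R I M\<rparr>"

definition annihilator ::
    "('a, 'c) ring_scheme \<Rightarrow> ('a, 'b, 'd) module_scheme \<Rightarrow> 'b \<Rightarrow> 'a set" where
  "annihilator R M x = {r \<in> carrier R. r \<odot>\<^bsub>M\<^esub> x = \<zero>\<^bsub>M\<^esub>}"

definition minimal_primes_over :: "('a, 'c) ring_scheme \<Rightarrow> 'a set \<Rightarrow> 'a set set" where
  "minimal_primes_over R I = {P \<in> Var R I. \<forall>Q \<in> Var R I. Q \<subseteq> P \<longrightarrow> Q = P}"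

definition weak_assassin ::
    "('a, 'c) ring_scheme \<Rightarrow> ('a, 'b, 'd) module_scheme \<Rightarrow> 'a set set" where
  "weak_assassin R M =
     {P. \<exists>x \<in> carrier M. P \<in> minimal_primes_over R (annihilator R M x)}"

definition weakly_quasifair ::
    "('a, 'c) ring_scheme \<Rightarrow> 'a set \<Rightarrow> ('a, 'b, 'd) module_scheme \<Rightarrow> bool" where
  "weakly_quasifair R I M \<longleftrightarrow>
     weak_assassin R (torsion_module R I M) = weak_assassin R M \<inter> Var R I"

definition finite_type_ideal :: "('a, 'c) ring_scheme \<Rightarrow> 'a set \<Rightarrow> bool" where
  "finite_type_ideal R I \<longleftrightarrow>
     (\<exists>A. finite A \<and> A \<subseteq> carrier R \<and> I = Idl\<^bsub>R\<^esub> A)"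

end

theory Submission
  imports Defs
begin

text \<open>
  A prime that is minimal over the annihilator of an \<open>I\<close>-torsion element \<open>x\<close> contains a power
  of \<open>I\<close>, hence \<open>I\<close> itself; this direction holds for every ideal \<open>I\<close>.

  Conversely, let \<open>P \<supseteq> I\<close> be minimal over the annihilator \<open>J\<close> of some element \<open>x\<close>. In the
  localization at \<open>P\<close> the prime \<open>P\<close> is the only one above \<open>J\<close>, so its elements are nilpotent
  modulo \<open>J\<close> there. Without denominators this reads: every \<open>a \<in> P\<close> admits \<open>s \<notin> P\<close> and \<open>n\<close>
  with \<open>s a\<^sup>n \<in> J\<close> (\<open>minimal_prime_nilpotent\<close>). It is obtained from Krull's theorem on primes
  avoiding a multiplicative set (\<open>exists_prime_avoiding\<close>) instead of by constructing the
  localization. As \<open>I\<close> has finitely many generators, the product of the corresponding elements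
  is one \<open>s \<notin> P\<close> for which every generator has a power annihilating \<open>y = s x\<close>; then a power of
  the whole ideal \<open>I\<close> annihilates \<open>y\<close> (\<open>torsion_if_generators_nilpotent\<close>). Replacing \<open>x\<close>
  by \<open>y\<close> is harmless: since \<open>s \<notin> P\<close>, the annihilator of \<open>y\<close> lies between \<open>J\<close> and \<open>P\<close>, so \<open>P\<close>
  is minimal over it as well (\<open>minimal_over_annihilator_smult\<close>).
\<close>

section \<open>Prime ideals avoiding a multiplicative set\<close>

lemma (in ring) ideal_Union_chain:
  assumes C: "subset.chain {K. ideal K R} C" "C \<noteq> {}"
  shows "ideal (\<Union>C) R"
proof -
  have ideals: "ideal K R" if "K \<in> C" for K
    using C(1) that by (auto simp: pred_on.chain_def)
  then have subgroups: "additive_subgroup K R" if "K \<in> C" for K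
    using that by (simp add: ideal.axioms(1))
  have common: "\<exists>K\<in>C. a \<in> K \<and> b \<in> K" if "a \<in> \<Union>C" "b \<in> \<Union>C" for a b
    using C(1) that unfolding pred_on.chain_def by blast
  show ?thesis
  proof (rule idealI[OF ring_axioms])
    show "subgroup (\<Union>C) (add_monoid R)"
    proof (rule add.subgroupI)
      show "\<Union>C \<subseteq> carrier R"
        using ideals ideal.Icarr by fastforce
      show "\<Union>C \<noteq> {}"
        using C(2) subgroups additive_subgroup.zero_closed by fastforce
    next
      fix a b assume "a \<in> \<Union>C" "b \<in> \<Union>C"
      then show "a \<oplus> b \<in> \<Union>C"
        using common subgroups additive_subgroup.a_closed by (meson UnionI)
    next
      fix a assume "a \<in> \<Union>C"
      then show "\<ominus> a \<in> \<Union>C"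
        using subgroups ideals ring_axioms by (meson UnionE UnionI additive_subgroup.a_inv_closed)
    qed
  next
    fix a x assume "a \<in> \<Union>C" "x \<in> carrier R"
    then show "x \<otimes> a \<in> \<Union>C" "a \<otimes> x \<in> \<Union>C"
      using ideals ideal.I_l_closed ideal.I_r_closed by (metis UnionE UnionI)+
  qed
qed

text \<open>
  An ideal \<open>Q\<close> maximal among those avoiding \<open>S\<close> is prime. Each colon ideal \<open>(Q : c)\<close> contains
  \<open>Q\<close>, so by maximality it meets \<open>S\<close> once it is strictly larger. If \<open>a b \<in> Q\<close> with neither
  factor in \<open>Q\<close>, this applies to \<open>(Q : a) \<ni> b\<close> and gives \<open>s \<in> S\<close> with \<open>a s \<in> Q\<close>, then applies to
  \<open>(Q : s) \<ni> a\<close> and gives \<open>t \<in> S\<close> with \<open>s t \<in> Q\<close>.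
\<close>

lemma (in cring) exists_prime_avoiding:
  assumes J: "ideal J R" and S: "S \<subseteq> carrier R" "S \<noteq> {}"
    and mult: "\<And>s t. s \<in> S \<Longrightarrow> t \<in> S \<Longrightarrow> s \<otimes> t \<in> S"
    and disj: "J \<inter> S = {}"
  obtains Q where "primeideal Q R" "J \<subseteq> Q" "Q \<inter> S = {}"
proof -
  define F where "F = {K. ideal K R \<and> J \<subseteq> K \<and> K \<inter> S = {}}"
  have "\<exists>Q\<in>F. \<forall>K\<in>F. Q \<subseteq> K \<longrightarrow> K = Q"
  proof (rule subset_Zorn_nonempty)
    show "F \<noteq> {}"
      using J disj by (auto simp: F_def)
    fix C assume C: "C \<noteq> {}" "subset.chain F C"
    then have sub: "C \<subseteq> F"
      by (simp add: pred_on.chain_def)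
    have "subset.chain {K. ideal K R} C"
      using C(2) by (auto simp: pred_on.chain_def F_def)
    then have "ideal (\<Union>C) R"
      using C(1) by (rule ideal_Union_chain)
    then show "\<Union>C \<in> F"
      using sub C(1) unfolding F_def by blast
  qed
  then obtain Q where Q: "ideal Q R" "J \<subseteq> Q" "Q \<inter> S = {}"
    and max: "\<And>K. K \<in> F \<Longrightarrow> Q \<subseteq> K \<Longrightarrow> K = Q"
    by (auto simp: F_def)
  have meets: "\<exists>s\<in>S. c \<otimes> s \<in> Q"
    if c: "c \<in> carrier R" and d: "d \<in> carrier R" "c \<otimes> d \<in> Q" "d \<notin> Q" for c d
  proof (rule ccontr)
    assume none: "\<not> (\<exists>s\<in>S. c \<otimes> s \<in> Q)"
    let ?K = "{r \<in> carrier R. c \<otimes> r \<in> Q}"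
    have "ideal ?K R"
      using ideal.helper_max_prime[OF Q(1) is_cring c] .
    moreover have "Q \<subseteq> ?K"
      using Q(1) c by (auto intro: ideal.I_l_closed ideal.Icarr)
    ultimately have "?K = Q"
      using none Q(2) by (intro max) (auto simp: F_def)
    then show False
      using d by blast
  qed
  have "primeideal Q R"
  proof (rule primeidealI[OF Q(1) is_cring])
    show "carrier R \<noteq> Q"
      using Q(3) S by blast
    fix a b assume ab: "a \<in> carrier R" "b \<in> carrier R" "a \<otimes> b \<in> Q"
    show "a \<in> Q \<or> b \<in> Q"
    proof (rule ccontr)
      assume neither: "\<not> (a \<in> Q \<or> b \<in> Q)"
      then obtain s where s: "s \<in> S" "a \<otimes> s \<in> Q"
        using meets ab by blast
      then have "s \<otimes> a \<in> Q"
        using S(1) ab(1) m_comm[of s a] by auto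
      then obtain t where "t \<in> S" "s \<otimes> t \<in> Q"
        using meets[of s a] neither s(1) S(1) ab(1) by blast
      then show False
        using mult s(1) Q(3) by blast
    qed
  qed
  then show ?thesis
    using that Q(2,3) by blast
qed

text \<open>
  Otherwise \<open>J\<close> avoids the multiplicative set of all \<open>s a\<^sup>n\<close> with \<open>s \<notin> P\<close>, hence so does some
  prime \<open>Q \<supseteq> J\<close>. The exponent \<open>n = 0\<close> gives \<open>Q \<subseteq> P\<close>, so \<open>Q = P\<close> by minimality, while
  \<open>s = 1\<close>, \<open>n = 1\<close> gives \<open>a \<notin> Q\<close>.
\<close>

lemma (in cring) minimal_prime_nilpotent:
  assumes J: "ideal J R" and P: "P \<in> minimal_primes_over R J" and a: "a \<in> P"
  shows "\<exists>s \<in> carrier R - P. \<exists>n::nat. s \<otimes> a [^] n \<in> J"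
proof (rule ccontr)
  assume none: "\<not> (\<exists>s \<in> carrier R - P. \<exists>n::nat. s \<otimes> a [^] n \<in> J)"
  interpret P: primeideal P R
    using P by (simp add: minimal_primes_over_def Var_def)
  have aR [simp]: "a \<in> carrier R"
    using a by (rule P.Icarr)
  have one: "\<one> \<in> carrier R - P"
    using P.I_notcarr P.one_imp_carrier by auto
  define S where "S = {s \<otimes> a [^] n | s n::nat. s \<in> carrier R - P}"
  have "\<one> \<otimes> a [^] (0::nat) \<in> S"
    using one unfolding S_def by blast
  moreover have "S \<subseteq> carrier R"
    by (auto simp: S_def)
  moreover have "x \<otimes> y \<in> S" if xyS: "x \<in> S" "y \<in> S" for x y
  proof -
    obtain s t and m n :: nat where st: "s \<in> carrier R - P" "t \<in> carrier R - P"
      and xy: "x = s \<otimes> a [^] m" "y = t \<otimes> a [^] n"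
      using xyS by (auto simp: S_def)
    have "x \<otimes> y = (s \<otimes> t) \<otimes> a [^] (m + n)"
      using st by (simp add: xy nat_pow_mult[symmetric] m_ac)
    moreover have "s \<otimes> t \<in> carrier R - P"
      using st P.I_prime by auto
    ultimately show ?thesis
      unfolding S_def by blast
  qed
  moreover have "J \<inter> S = {}"
    using none by (auto simp: S_def)
  ultimately obtain Q where Q: "primeideal Q R" "J \<subseteq> Q" "Q \<inter> S = {}"
    using exists_prime_avoiding[OF J] by blast
  have "Q \<subseteq> P"
  proof
    fix q assume q: "q \<in> Q"
    then have qR: "q \<in> carrier R"
      using Q(1) by (meson ideal.Icarr primeideal.axioms(1))
    show "q \<in> P"
    proof (rule ccontr)
      assume "q \<notin> P"
      then have "q \<otimes> a [^] (0::nat) \<in> S"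
        using qR unfolding S_def by blast
      then show False
        using q qR Q(3) by auto
    qed
  qed
  then have "Q = P"
    using P Q(1,2) by (simp add: minimal_primes_over_def Var_def)
  moreover have "\<one> \<otimes> a [^] (1::nat) \<in> S"
    using one unfolding S_def by blast
  ultimately show False
    using Q(3) a by auto
qed

section \<open>Powers of ideals\<close>

lemma ideal_pow_0 [simp]: "ideal_pow R I 0 = carrier R"
  by (simp add: ideal_pow_def nat_pow_def ideals_set_def)

lemma ideal_pow_Suc [simp]: "ideal_pow R I (Suc n) = ideal_prod R (ideal_pow R I n) I"
  by (simp add: ideal_pow_def nat_pow_def ideals_set_def)

lemma (in ring) ideal_ideal_pow: "ideal I R \<Longrightarrow> ideal (ideal_pow R I n) R"
  by (induction n) (simp_all add: oneideal ideal_prod_is_ideal)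

lemma (in primeideal) ideal_pow_subset_imp_subset:
  assumes K: "ideal K R" and sub: "ideal_pow R K n \<subseteq> I"
  shows "K \<subseteq> I"
  using sub
proof (induction n)
  case 0
  then show ?case
    using I_notcarr a_subset by simp
next
  case (Suc n)
  show ?case
  proof (rule ccontr)
    assume "\<not> K \<subseteq> I"
    then obtain k where k: "k \<in> K" "k \<notin> I"
      by blast
    have "ideal_pow R K n \<subseteq> I"
    proof
      fix r assume r: "r \<in> ideal_pow R K n"
      then have "r \<otimes> k \<in> I"
        using Suc.prems k(1) by (auto intro: ideal_prod.prod)
      then show "r \<in> I"
        using I_prime k r ideal.Icarr[OF K] ideal.Icarr[OF ideal_ideal_pow[OF K]] by blast
    qed
    with Suc.IH \<open>\<not> K \<subseteq> I\<close> show False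
      by blast
  qed
qed

section \<open>Annihilators and torsion\<close>

context module
begin

lemma annihilator_ideal:
  assumes x: "x \<in> carrier M"
  shows "ideal (annihilator R M x) R"
proof (rule idealI)
  show "subgroup (annihilator R M x) (add_monoid R)"
    using x
    by (intro R.add.subgroupI)
      (auto simp: annihilator_def smult_l_distr smult_l_minus a_inv_def[symmetric]
        intro!: exI[of _ \<zero>])
next
  fix a r assume "a \<in> annihilator R M x" "r \<in> carrier R"
  then show "r \<otimes> a \<in> annihilator R M x" "a \<otimes> r \<in> annihilator R M x"
    using x R.m_comm[of a r] by (auto simp: annihilator_def smult_assoc1)
qed (rule R.ring_axioms)

lemma annihilator_smult:
  assumes "s \<in> carrier R" "x \<in> carrier M"
  shows "r \<in> annihilator R M (s \<odot>\<^bsub>M\<^esub> x) \<longleftrightarrow> r \<in> carrier R \<and> s \<otimes> r \<in> annihilator R M x"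
  using assms R.m_comm[of r s] by (auto simp: annihilator_def smult_assoc1[symmetric])

lemma torsion_iff:
  assumes "ideal I R"
  shows "x \<in> torsion R I M \<longleftrightarrow>
    x \<in> carrier M \<and> (\<exists>n. ideal_pow R I n \<subseteq> annihilator R M x)"
  using ideal.Icarr[OF R.ideal_ideal_pow[OF assms]]
  by (fastforce simp: torsion_def annihilator_def)

lemma minimal_over_annihilator_smult:
  assumes x: "x \<in> carrier M" and P: "P \<in> minimal_primes_over R (annihilator R M x)"
    and s: "s \<in> carrier R - P"
  shows "P \<in> minimal_primes_over R (annihilator R M (s \<odot>\<^bsub>M\<^esub> x))"
proof -
  interpret P: primeideal P R
    using P by (simp add: minimal_primes_over_def Var_def)
  have sub: "annihilator R M x \<subseteq> P"
    using P by (simp add: minimal_primes_over_def Var_def)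
  have "annihilator R M (s \<odot>\<^bsub>M\<^esub> x) \<subseteq> P"
  proof
    fix r assume "r \<in> annihilator R M (s \<odot>\<^bsub>M\<^esub> x)"
    then have "r \<in> carrier R" "s \<otimes> r \<in> P"
      using sub s x by (auto simp: annihilator_smult)
    then show "r \<in> P"
      using P.I_prime s by blast
  qed
  moreover have "annihilator R M x \<subseteq> annihilator R M (s \<odot>\<^bsub>M\<^esub> x)"
    using annihilator_ideal[OF x] s x
    by (auto simp: annihilator_smult intro: ideal.I_l_closed ideal.Icarr)
  ultimately show ?thesis
    using P unfolding minimal_primes_over_def Var_def by blast
qed

text \<open>
  If all generators have powers that annihilate \<open>y\<close>, multiplying \<open>y\<close> by one generator \<open>a\<close> lowers
  the exponent needed for \<open>a\<close> and keeps the others valid, so the sum of the exponents drops. The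
  elements \<open>r\<close> for which a fixed power of the ideal kills \<open>r y\<close> form an ideal; it therefore
  suffices to let \<open>r\<close> range over the generators. The extra \<open>1\<close> in the exponent covers the
  exponent sum \<open>0\<close>, where the zeroth power, the unit ideal, kills \<open>y\<close> only if \<open>y\<close> vanishes, which
  an empty set of generators does not force.
\<close>

lemma ideal_pow_annihilates:
  fixes f :: "'a \<Rightarrow> nat"
  assumes A: "finite A" "A \<subseteq> carrier R" and y: "y \<in> carrier M"
    and f: "\<And>a. a \<in> A \<Longrightarrow> a [^] f a \<in> annihilator R M y"
  shows "ideal_pow R (Idl A) (Suc (sum f A)) \<subseteq> annihilator R M y"
  using y f
proof (induction "sum f A" arbitrary: f y rule: less_induct)
  case less
  note y = less.prems(1)
  let ?N = "sum f A"
  let ?I = "Idl A"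
  have I: "ideal ?I R"
    using A(2) by (rule R.genideal_ideal)
  note pow_carr = ideal.Icarr[OF R.ideal_ideal_pow[OF I]]
  define K where "K = {r \<in> carrier R. ideal_pow R ?I ?N \<subseteq> annihilator R M (r \<odot>\<^bsub>M\<^esub> y)}"
  have K_iff: "r \<in> K \<longleftrightarrow>
      r \<in> carrier R \<and> (\<forall>q \<in> ideal_pow R ?I ?N. q \<otimes> r \<in> annihilator R M y)" for r
    using y pow_carr by (auto simp: K_def annihilator_smult m_comm subset_iff)
  have "ideal K R"
  proof (rule idealI)
    note ann = annihilator_ideal[OF y]
    show "subgroup K (add_monoid R)"
    proof (rule R.add.subgroupI)
      show "K \<subseteq> carrier R"
        by (auto simp: K_def)
      have "\<zero> \<in> K"
        using pow_carr y by (auto simp: K_iff annihilator_def)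
      then show "K \<noteq> {}"
        by blast
    next
      fix a assume a: "a \<in> K"
      show "\<ominus> a \<in> K"
        using a pow_carr additive_subgroup.a_inv_closed[OF ideal.axioms(1)[OF ann]]
        by (simp add: K_iff R.r_minus)
    next
      fix a b assume ab: "a \<in> K" "b \<in> K"
      show "a \<oplus> b \<in> K"
        using ab pow_carr additive_subgroup.a_closed[OF ideal.axioms(1)[OF ann]]
        by (simp add: K_iff R.r_distr)
    qed
    fix a r assume ar: "a \<in> K" "r \<in> carrier R"
    show "a \<otimes> r \<in> K"
      using ar pow_carr ideal.I_r_closed[OF ann]
      by (auto simp: K_iff R.m_assoc[symmetric])
    then show "r \<otimes> a \<in> K"
      using ar by (simp add: K_iff R.m_comm)
  qed (rule R.ring_axioms)
  moreover have "A \<subseteq> K"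
  proof
    fix a assume a: "a \<in> A"
    then have aR: "a \<in> carrier R"
      using A(2) by blast
    show "a \<in> K"
    proof (cases "f a")
      case 0
      then have "y = \<zero>\<^bsub>M\<^esub>"
        using less.prems(2)[OF a] y by (simp add: annihilator_def)
      then show ?thesis
        using aR pow_carr by (auto simp: K_def annihilator_def)
    next
      case (Suc k)
      let ?g = "f(a := k)"
      have sum_g: "?N = Suc (sum ?g A)"
        using Suc by (simp add: sum.remove[OF A(1) a])
      have "b [^] ?g b \<in> annihilator R M (a \<odot>\<^bsub>M\<^esub> y)" if b: "b \<in> A" for b
      proof (cases "b = a")
        case True
        then show ?thesis
          using less.prems(2)[OF a] aR y Suc by (simp add: annihilator_smult R.m_comm)
      next
        case False
        then show ?thesis
          using less.prems(2)[OF b] b A(2) aR y ideal.I_l_closed[OF annihilator_ideal[OF y]]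
          by (auto simp: annihilator_smult)
      qed
      then have "ideal_pow R ?I (Suc (sum ?g A)) \<subseteq> annihilator R M (a \<odot>\<^bsub>M\<^esub> y)"
        using less.hyps[of ?g "a \<odot>\<^bsub>M\<^esub> y"] sum_g aR y by simp
      then show ?thesis
        unfolding K_def sum_g using aR by blast
    qed
  qed
  ultimately have sub: "?I \<subseteq> K"
    by (rule R.genideal_minimal)
  show ?case
  proof
    fix r assume "r \<in> ideal_pow R ?I (Suc ?N)"
    then have "r \<in> ideal_prod R (ideal_pow R ?I ?N) ?I"
      by simp
    then show "r \<in> annihilator R M y"
    proof (induction rule: ideal_prod.induct)
      case (prod q i)
      then show ?case
        using sub K_iff by blast
    next
      case (sum r s)
      then show ?case
        using annihilator_ideal[OF y]
        by (simp add: additive_subgroup.a_closed ideal.axioms(1))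
    qed
  qed
qed

lemma torsion_if_generators_nilpotent:
  assumes A: "finite A" "A \<subseteq> carrier R" and y: "y \<in> carrier M"
    and nil: "\<And>a. a \<in> A \<Longrightarrow> \<exists>n::nat. a [^] n \<in> annihilator R M y"
  shows "y \<in> torsion R (Idl A) M"
proof -
  obtain f :: "'a \<Rightarrow> nat" where "\<And>a. a \<in> A \<Longrightarrow> a [^] f a \<in> annihilator R M y"
    using nil by metis
  then have "ideal_pow R (Idl A) (Suc (sum f A)) \<subseteq> annihilator R M y"
    by (rule ideal_pow_annihilates[OF A y])
  then show ?thesis
    using torsion_iff[OF R.genideal_ideal[OF A(2)]] y by blast
qed

text \<open>
  The multipliers of the individual elements of \<open>A\<close> are multiplied together; their product stays
  outside \<open>P\<close> because \<open>P\<close> is prime, and here finiteness of \<open>A\<close> enters.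
\<close>

lemma common_multiplier:
  assumes A: "finite A" "A \<subseteq> P" and x: "x \<in> carrier M"
    and P: "P \<in> minimal_primes_over R (annihilator R M x)"
  shows "\<exists>s \<in> carrier R - P. \<forall>a \<in> A. \<exists>n::nat. a [^] n \<in> annihilator R M (s \<odot>\<^bsub>M\<^esub> x)"
  using A
proof (induction A rule: finite_induct)
  interpret P: primeideal P R
    using P by (simp add: minimal_primes_over_def Var_def)
  case empty
  show ?case
    using P.I_notcarr P.a_subset by auto
next
  interpret P: primeideal P R
    using P by (simp add: minimal_primes_over_def Var_def)
  note ann = annihilator_ideal[OF x]
  case (insert a A)
  then obtain s where s: "s \<in> carrier R - P"
    and s_nil: "\<forall>b \<in> A. \<exists>n::nat. b [^] n \<in> annihilator R M (s \<odot>\<^bsub>M\<^esub> x)"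
    by auto
  obtain t and n :: nat where t: "t \<in> carrier R - P" and tn: "t \<otimes> a [^] n \<in> annihilator R M x"
    using R.minimal_prime_nilpotent[OF ann P, of a] insert.prems by blast
  have "s \<otimes> t \<in> carrier R - P"
    using s t P.I_prime by auto
  moreover have "\<exists>n::nat. b [^] n \<in> annihilator R M ((s \<otimes> t) \<odot>\<^bsub>M\<^esub> x)"
    if b: "b \<in> insert a A" for b
  proof -
    have bR: "b \<in> carrier R"
      using b insert.prems P.Icarr by blast
    show ?thesis
    proof (cases "b = a")
      case True
      have "s \<otimes> (t \<otimes> a [^] n) \<in> annihilator R M x"
        using tn s ideal.I_l_closed[OF ann] by blast
      then show ?thesis
        using True bR s t x by (auto simp: annihilator_smult R.m_assoc)
    next
      case False
      then obtain m :: nat where "b [^] m \<in> annihilator R M (s \<odot>\<^bsub>M\<^esub> x)"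
        using b s_nil by blast
      then have "t \<otimes> (s \<otimes> b [^] m) \<in> annihilator R M x"
        using t s x ideal.I_l_closed[OF ann] by (auto simp: annihilator_smult)
      then have "b [^] m \<in> annihilator R M ((s \<otimes> t) \<odot>\<^bsub>M\<^esub> x)"
        using bR s t x by (simp add: annihilator_smult R.m_ac)
      then show ?thesis ..
    qed
  qed
  ultimately show ?case
    by blast
qed

end

section \<open>Weak quasifairness\<close>

theorem mainTheorem8:
  fixes R :: "('a, 'c) ring_scheme" and I :: "'a set"
    and M :: "('a, 'b, 'd) module_scheme"
  assumes "cring R" and "ideal I R" and "finite_type_ideal R I"
    and "module R M"
  shows "weakly_quasifair R I M"
proof -
  interpret module R M
    by fact
  have wa_torsion: "P \<in> weak_assassin R (torsion_module R I M) \<longleftrightarrow>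
      (\<exists>x \<in> torsion R I M. P \<in> minimal_primes_over R (annihilator R M x))" for P
    by (simp add: weak_assassin_def annihilator_def)
  show ?thesis
    unfolding weakly_quasifair_def
  proof (intro equalityI subsetI)
    fix P assume "P \<in> weak_assassin R (torsion_module R I M)"
    then obtain x where x: "x \<in> torsion R I M"
      and P: "P \<in> minimal_primes_over R (annihilator R M x)"
      using wa_torsion by blast
    interpret P: primeideal P R
      using P by (simp add: minimal_primes_over_def Var_def)
    obtain n where xM: "x \<in> carrier M" and "ideal_pow R I n \<subseteq> annihilator R M x"
      using x torsion_iff[OF assms(2)] by blast
    then have "ideal_pow R I n \<subseteq> P"
      using P by (auto simp: minimal_primes_over_def Var_def)
    then have "I \<subseteq> P"
      by (rule P.ideal_pow_subset_imp_subset[OF assms(2)])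
    then show "P \<in> weak_assassin R M \<inter> Var R I"
      using xM P P.primeideal by (auto simp: weak_assassin_def Var_def)
  next
    fix P assume "P \<in> weak_assassin R M \<inter> Var R I"
    then obtain x where x: "x \<in> carrier M" and IP: "I \<subseteq> P"
      and P: "P \<in> minimal_primes_over R (annihilator R M x)"
      by (auto simp: weak_assassin_def Var_def)
    obtain A where A: "finite A" "A \<subseteq> carrier R" and I: "I = Idl\<^bsub>R\<^esub> A"
      using assms(3) by (auto simp: finite_type_ideal_def)
    have "A \<subseteq> P"
      using IP I R.genideal_self[OF A(2)] by blast
    then obtain s where s: "s \<in> carrier R - P"
      and nil: "\<forall>a \<in> A. \<exists>n::nat. a [^]\<^bsub>R\<^esub> n \<in> annihilator R M (s \<odot>\<^bsub>M\<^esub> x)"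
      using common_multiplier[OF A(1) _ x P] by blast
    have "s \<odot>\<^bsub>M\<^esub> x \<in> torsion R I M"
      unfolding I using A s x nil by (intro torsion_if_generators_nilpotent) auto
    moreover have "P \<in> minimal_primes_over R (annihilator R M (s \<odot>\<^bsub>M\<^esub> x))"
      using x P s by (rule minimal_over_annihilator_smult)
    ultimately show "P \<in> weak_assassin R (torsion_module R I M)"
      using wa_torsion by blast
  qed
qed

end
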